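(* Let $m,n,p,r$ be positive integers, let $q\in V(m,n,p;r)$, and let $\mathcal{A}^q=\{t_1^q,\dots,t_r^q\}$, $t_i^q=u_i^q\otimes v_i^q\otimes w_i^q$, be the corresponding algorithm of length $r$ computing $\langle m,n,p\rangle$. If $\mathcal{A}^q$ has $D$-property, then $$\dim_q V(m,n,p;r)\ \ge\ m^2+n^2+p^2-m-n-p-3.$$
   Context: All vector spaces are over $\mathbb{C}$. The matrix multiplication tensor is $\langle m,n,p\rangle=\sum_{i=1}^m\sum_{j=1}^n\sum_{k=1}^p e_{ij}\otimes e_{jk}\otimes e_{ki}\in\mathbb{C}^{m\times n}\otimes\mathbb{C}^{n\times p}\otimes\mathbb{C}^{p\times m}$, where $e_{ij}$ are matrix units. An algorithm of length $r$ computing a tensor $t$ is a set $\{t_1,\dots,t_r\}$ of decomposable tensors with $t=t_1+\cdots+t_r$. The Brent equations $B(m,n,p;r)$ are the polynomial equations in the $(mn+np+pm)r$ unknowns $\alpha^{(i)}_{i_1,i_2},\beta^{(i)}_{j_1,j_2},\gamma^{(i)}_{k_1,k_2}$ ($1\le i\le r$): $$\sum_{i=1}^r\alpha^{(i)}_{i_1,i_2}\beta^{(i)}_{j_1,j_2}\gamma^{(i)}_{k_1,k_2}=\delta_{i_2,j_1}\delta_{j_2,k_1}\delta_{k_2,i_1},$$ for all $k_2,i_1\in\{1,\dots,m\}$, $i_2,j_1\in\{1,\dots,n\}$, $j_2,k_1\in\{1,\dots,p\}$. $V(m,n,p;r)\subseteq\mathbb{C}^{(mn+np+pm)r}$ is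 its complex solution set. A point $q\in V(m,n,p;r)$ corresponds to the decomposition $\langle m,n,p\rangle=\sum_{i=1}^r u_i^q\otimes v_i^q\otimes w_i^q$ with $u_i^q=(\alpha^{(i)}_{i_1,i_2})\in\mathbb{C}^{m\times n}$, $v_i^q=(\beta^{(i)}_{j_1,j_2})\in\mathbb{C}^{n\times p}$, $w_i^q=(\gamma^{(i)}_{k_1,k_2})\in\mathbb{C}^{p\times m}$. The local dimension $\dim_q V$ of an affine variety (Zariski closed set) $V$ at $q$ is the maximum dimension of an irreducible component of $V$ containing $q$. $D$-property: $\mathcal{R}:\mathbb{C}^{m\times n}\to\mathbb{C}^{mn\times1}$ concatenates the rows of a matrix into a column vector (similarly for other sizes); $a\otimes b=(a_{ij}b)$ denotes the Kronecker product of matrices. Let $\mathcal{A}=\{u_i\otimes v_i\otimes w_i\mid i=1,\dots,r\}$ compute $\langle m,n,p\rangle$; then the $u_i$, $v_i$, $w_i$ span $\mathbb{C}^{m\times n}$, $\mathbb{C}^{n\times p}$, $\mathbb{C}^{p\times m}$ respectively. The set $\{u_1,\dots,u_r\}$ has $D$-property if for some maximal linearly independent subset $\{u_{i_1},\dots,u_{i_{mn}}\}$ (listed in some order) the invertible matrix $(\mathcal{R}(u_{i_1}),\dots,\mathcal{R}(u_{i_{mn}}))$ equals $U_m\otimes U_n$ for some $U_m\in GL_m(\mathbb{C})$, $U_n\in GL_n(\mathbb{C})$. Similarly $\{v_i\}$ has $D$-property if such a matrix of vectorized $v_i$'s equals $V_n\otimes V_p$ with $V_n\in GL_n(\mathbb{C})$,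 $V_p\in GL_p(\mathbb{C})$, and $\{w_i\}$ has $D$-property if such a matrix of vectorized $w_i$'s equals $W_p\otimes W_m$ with $W_p\in GL_p(\mathbb{C})$, $W_m\in GL_m(\mathbb{C})$. The algorithm $\mathcal{A}$ has $D$-property if (at least) two of the three sets $\{u_i\}$, $\{v_i\}$, $\{w_i\}$ have $D$-property. *)

theory Defs
  imports "HOL-Analysis.Analysis"
begin

section \<open>Dimension of complex affine varieties\<close>

text \<open>
  Affine space with coordinates indexed by a (finite) type \<open>'v\<close> is the function type
  \<open>'v \<Rightarrow> complex\<close>. Since \<open>\<complex>\<close> is infinite, polynomials are identified with the functions
  they induce.
\<close>

type_synonym 'v point = "'v \<Rightarrow> complex"

inductive poly_fn :: "('v point \<Rightarrow> complex) \<Rightarrow> bool" where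
  const: "poly_fn (\<lambda>x. c)"
| coord: "poly_fn (\<lambda>x. x i)"
| add: "poly_fn f \<Longrightarrow> poly_fn g \<Longrightarrow> poly_fn (\<lambda>x. f x + g x)"
| mult: "poly_fn f \<Longrightarrow> poly_fn g \<Longrightarrow> poly_fn (\<lambda>x. f x * g x)"

definition zariski_closed :: "'v point set \<Rightarrow> bool" where
  "zariski_closed S \<longleftrightarrow> (\<exists>P. (\<forall>f\<in>P. poly_fn f) \<and> S = {x. \<forall>f\<in>P. f x = 0})"

definition irreducible_closed :: "'v point set \<Rightarrow> bool" where
  "irreducible_closed S \<longleftrightarrow> zariski_closed S \<and> S \<noteq> {} \<and>
     (\<forall>A B. zariski_closed A \<and> zariski_closed B \<and> S = A \<union> B \<longrightarrow> S = A \<or> S = B)"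

definition irreducible_component :: "'v point set \<Rightarrow> 'v point set \<Rightarrow> bool" where
  "irreducible_component Z V \<longleftrightarrow> irreducible_closed Z \<and> Z \<subseteq> V \<and>
     (\<forall>Z'. irreducible_closed Z' \<and> Z \<subseteq> Z' \<and> Z' \<subseteq> V \<longrightarrow> Z' = Z)"

text \<open>
  The dimension is the supremum of the lengths \<open>k\<close> of chains
  \<open>C 0 \<subset> C 1 \<subset> \<dots> \<subset> C k\<close> of irreducible closed subsets.
\<close>

definition variety_dim :: "'v point set \<Rightarrow> enat" where
  "variety_dim S = Sup {enat k | k. \<exists>C :: nat \<Rightarrow> 'v point set.
     (\<forall>i\<le>k. irreducible_closed (C i) \<and> C i \<subseteq> S) \<and> (\<forall>i<k. C i \<subset> C (Suc i))}"

definition local_dim :: "'v point set \<Rightarrow> 'v point \<Rightarrow> enat" where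
  "local_dim V q = Sup (variety_dim ` {Z. irreducible_component Z V \<and> q \<in> Z})"


section \<open>The Brent equations\<close>

text \<open>
  The numbers \<open>m, n, p, r\<close> are the cardinalities of the finite index types
  \<open>'m, 'n, 'p, 'r\<close>; an \<open>m \<times> n\<close> matrix has type \<open>complex^'n^'m\<close>.
\<close>

datatype ('m, 'n, 'p, 'r) brent_unknown =
  Alpha 'r 'm 'n | Beta 'r 'n 'p | Gamma 'r 'p 'm

definition brent_variety ::
    "('m::finite, 'n::finite, 'p::finite, 'r::finite) brent_unknown point set" where
  "brent_variety = {q. \<forall>i1 i2 j1 j2 k1 k2.
     (\<Sum>i\<in>UNIV. q (Alpha i i1 i2) * q (Beta i j1 j2) * q (Gamma i k1 k2)) =
     of_bool (i2 = j1) * of_bool (j2 = k1) * of_bool (k2 = i1)}"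

definition alg_u ::
    "('m::finite, 'n::finite, 'p::finite, 'r::finite) brent_unknown point \<Rightarrow> 'r \<Rightarrow> complex^'n^'m" where
  "alg_u q i = (\<chi> i1 i2. q (Alpha i i1 i2))"

definition alg_v ::
    "('m::finite, 'n::finite, 'p::finite, 'r::finite) brent_unknown point \<Rightarrow> 'r \<Rightarrow> complex^'p^'n" where
  "alg_v q i = (\<chi> j1 j2. q (Beta i j1 j2))"

definition alg_w ::
    "('m::finite, 'n::finite, 'p::finite, 'r::finite) brent_unknown point \<Rightarrow> 'r \<Rightarrow> complex^'m^'p" where
  "alg_w q i = (\<chi> k1 k2. q (Gamma i k1 k2))"


subsection \<open>Relation to the matrix multiplication tensor\<close>

text \<open>Elements of a tensor product of three matrix spaces are represented by their coordinates.\<close>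

type_synonym ('a, 'b, 'c, 'd, 'e, 'f) mat_tensor3 =
  "'a \<times> 'b \<Rightarrow> 'c \<times> 'd \<Rightarrow> 'e \<times> 'f \<Rightarrow> complex"

definition decomposable ::
    "complex^'b^'a \<Rightarrow> complex^'d^'c \<Rightarrow> complex^'f^'e \<Rightarrow> ('a, 'b, 'c, 'd, 'e, 'f) mat_tensor3" where
  "decomposable x y z = (\<lambda>(a, b) (c, d) (e, f). x $ a $ b * y $ c $ d * z $ e $ f)"

definition mat_unit :: "'a::finite \<Rightarrow> 'b::finite \<Rightarrow> complex^'b^'a" where
  "mat_unit i j = (\<chi> a b. of_bool (a = i \<and> b = j))"

definition matmul_tensor :: "('m::finite, 'n::finite, 'n, 'p::finite, 'p, 'm) mat_tensor3" where
  "matmul_tensor = (\<lambda>a b c. \<Sum>i\<in>UNIV. \<Sum>j\<in>UNIV. \<Sum>k\<in>UNIV.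
     decomposable (mat_unit i j) (mat_unit j k) (mat_unit k i) a b c)"

lemma matmul_tensor_eq:
  "matmul_tensor (i1, i2) (j1, j2) (k1, k2) =
     of_bool (i2 = j1) * of_bool (j2 = k1) * of_bool (k2 = i1)"
proof -
  have "matmul_tensor (i1, i2) (j1, j2) (k1, k2) =
    (\<Sum>i\<in>UNIV. \<Sum>j\<in>UNIV. \<Sum>k\<in>UNIV. if k = k1 then if j = j1 then if i = i1
       then of_bool (i2 = j1) * of_bool (j2 = k1) * of_bool (k2 = i1) else 0 else 0 else (0::complex))"
    unfolding matmul_tensor_def decomposable_def mat_unit_def
    by (intro sum.cong refl) auto
  then show ?thesis by simp
qed

lemma brent_variety_iff:
  "q \<in> brent_variety \<longleftrightarrow>
     matmul_tensor = (\<lambda>a b c. \<Sum>i\<in>UNIV. decomposable (alg_u q i) (alg_v q i) (alg_w q i) a b c)"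
  by (auto simp: brent_variety_def fun_eq_iff matmul_tensor_eq decomposable_def
      alg_u_def alg_v_def alg_w_def)


section \<open>The D-property\<close>

text \<open>
  Row-by-row vectorization and the Kronecker product, with \<open>'a \<times> 'b\<close> in place of the
  lexicographically ordered index set \<open>{1..ab}\<close>.
\<close>

definition vectorize :: "complex^'b^'a \<Rightarrow> complex^('a::finite \<times> 'b::finite)" where
  "vectorize x = (\<chi> s. x $ fst s $ snd s)"

definition kronecker ::
    "complex^'a^'a \<Rightarrow> complex^'b^'b \<Rightarrow> complex^('a::finite \<times> 'b::finite)^('a \<times> 'b)" where
  "kronecker x y = (\<chi> s t. x $ fst s $ fst t * y $ snd s $ snd t)"

text \<open>
  Linear independence over \<open>\<complex>\<close> is tested on the vectorized matrices; \<open>vectorize\<close> is a linear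
  isomorphism. The enumeration \<open>e\<close> lists the columns of the matrix in an arbitrary order.
\<close>

definition mat_independent :: "(complex^'b::finite^'a::finite) set \<Rightarrow> bool" where
  "mat_independent B \<longleftrightarrow> vec.independent (vectorize ` B)"

definition D_property_set :: "(complex^'b::finite^'a::finite) set \<Rightarrow> bool" where
  "D_property_set S \<longleftrightarrow> (\<exists>B e.
     B \<subseteq> S \<and> mat_independent B \<and>
     (\<forall>B'. B \<subseteq> B' \<and> B' \<subseteq> S \<and> mat_independent B' \<longrightarrow> B' = B) \<and>
     bij_betw e (UNIV :: ('a \<times> 'b) set) B \<and>
     (\<exists>(x :: complex^'a^'a) (y :: complex^'b^'b). invertible x \<and> invertible y \<and>
        (\<chi> row col. vectorize (e col) $ row) = kronecker x y))"

definition D_property ::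
    "('r \<Rightarrow> complex^'n::finite^'m::finite) \<Rightarrow> ('r \<Rightarrow> complex^'p::finite^'n) \<Rightarrow> ('r \<Rightarrow> complex^'m^'p) \<Rightarrow> bool" where
  "D_property u v w \<longleftrightarrow>
     (D_property_set (range u) \<and> D_property_set (range v)) \<or>
     (D_property_set (range u) \<and> D_property_set (range w)) \<or>
     (D_property_set (range v) \<and> D_property_set (range w))"

end

theory Submission
  imports Defs
begin

text \<open>
  The group \<open>GL\<^sub>m \<times> GL\<^sub>n \<times> GL\<^sub>p\<close> acts on the solutions of the Brent equations by
  \<open>(u, v, w) \<mapsto> (a u b\<^sup>-\<^sup>1, b v c\<^sup>-\<^sup>1, c w a\<^sup>-\<^sup>1)\<close>. Let each of \<open>a, b, c\<close> run through the
  products \<open>L U\<close> of a lower and an upper unitriangular matrix; these and their inverses depend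
  polynomially on the \<open>k\<^sup>2 - k\<close> off-diagonal entries of \<open>L\<close> and \<open>U\<close>. Since the Brent
  equations allow one to write every matrix unit as a combination of the \<open>u\<^sub>i\<close>, the entries
  of \<open>a\<close>, multiplied by the last diagonal entry of \<open>b\<^sup>-\<^sup>1\<close>, which is \<open>1\<close>, are linear functions
  of the point of the orbit, and \<open>L, U\<close> are polynomial functions of \<open>L U\<close>. So the
  parametrization of this part of the orbit has a polynomial left inverse, and it maps
  the coordinate subspaces to a strict chain of irreducible closed sets.
\<close>

section \<open>Polynomial functions and Zariski closed sets\<close>

lemma poly_fn_sum:
  assumes "\<And>i. i \<in> I \<Longrightarrow> poly_fn (f i)"
  shows "poly_fn (\<lambda>x. \<Sum>i\<in>I. f i x)"
  using assms
  by (induction I rule: infinite_finite_induct) (auto intro: poly_fn.intros)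

lemma poly_fn_diff:
  assumes "poly_fn f" "poly_fn g"
  shows "poly_fn (\<lambda>x. f x - g x)"
proof -
  have "poly_fn (\<lambda>x. f x + (-1) * g x)"
    using assms by (intro poly_fn.intros)
  then show ?thesis by simp
qed

lemma poly_fn_compose:
  assumes "poly_fn f" "\<And>i. poly_fn (\<lambda>x. h x i)"
  shows "poly_fn (\<lambda>x. f (h x))"
  using assms(1)
proof induction
  case (coord i)
  then show ?case by (rule assms(2))
qed (auto intro: poly_fn.intros)

text \<open>Along a line, a polynomial function is a polynomial in one variable, with finitely many
  roots unless it is zero. Irreducibility of affine space is reduced to this fact.\<close>

lemma poly_fn_on_line:
  assumes "poly_fn f"
  shows "\<exists>p. \<forall>t. f (\<lambda>i. x i + t * y i) = poly p t"
  using assms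
proof induction
  case (const c)
  show ?case by (rule exI[of _ "[:c:]"]) simp
next
  case (coord i)
  show ?case by (rule exI[of _ "[:x i, y i:]"]) simp
next
  case (add f g)
  then show ?case by (metis poly_add)
next
  case (mult f g)
  then show ?case by (metis poly_mult)
qed

lemma zariski_closed_zero_set:
  assumes "\<And>i. i \<in> I \<Longrightarrow> poly_fn (f i)"
  shows "zariski_closed {x. \<forall>i\<in>I. f i x = 0}"
  unfolding zariski_closed_def
  by (rule exI[of _ "f ` I"]) (use assms in auto)

lemma zariski_closed_Int:
  assumes "zariski_closed A" "zariski_closed B"
  shows "zariski_closed (A \<inter> B)"
proof -
  obtain P where "\<forall>f\<in>P. poly_fn f" "A = {x. \<forall>f\<in>P. f x = 0}"
    using assms(1) unfolding zariski_closed_def by blast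
  moreover obtain Q where "\<forall>f\<in>Q. poly_fn f" "B = {x. \<forall>f\<in>Q. f x = 0}"
    using assms(2) unfolding zariski_closed_def by blast
  ultimately show ?thesis
    unfolding zariski_closed_def by (intro exI[of _ "P \<union> Q"]) auto
qed

text \<open>The definition of irreducibility asks for an exact decomposition of \<open>S\<close>;
  intersecting both closed sets with \<open>S\<close> turns a cover into one.\<close>

lemma irreducible_closed_subset_cases:
  assumes "irreducible_closed S" "zariski_closed A" "zariski_closed B" "S \<subseteq> A \<union> B"
  shows "S \<subseteq> A \<or> S \<subseteq> B"
proof -
  have "zariski_closed S"
    using assms(1) by (simp add: irreducible_closed_def)
  then have "zariski_closed (S \<inter> A)" "zariski_closed (S \<inter> B)"
    using assms(2,3) by (simp_all add: zariski_closed_Int)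
  moreover have "S = (S \<inter> A) \<union> (S \<inter> B)" using assms(4) by blast
  ultimately have "S = S \<inter> A \<or> S = S \<inter> B"
    using assms(1) unfolding irreducible_closed_def by meson
  then show ?thesis by blast
qed

section \<open>Zariski closure and existence of irreducible components\<close>

definition zariski_closure :: "'v point set \<Rightarrow> 'v point set" where
  "zariski_closure X = {x. \<forall>f\<in>{f. poly_fn f \<and> (\<forall>y\<in>X. f y = 0)}. f x = 0}"

lemma zariski_closed_closure: "zariski_closed (zariski_closure X)"
  unfolding zariski_closure_def by (rule zariski_closed_zero_set) auto

lemma subset_zariski_closure: "X \<subseteq> zariski_closure X"
  by (auto simp: zariski_closure_def)

lemma zariski_closure_minimal:
  assumes "X \<subseteq> A" "zariski_closed A"
  shows "zariski_closure X \<subseteq> A"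
  using assms unfolding zariski_closure_def zariski_closed_def by blast

text \<open>Two points of the union that witness failure for \<open>A\<close> and for
  \<open>B\<close> lie in one common member of the chain, which is irreducible. This supplies the
  upper bounds for Zorn's lemma.\<close>

lemma irreducible_closed_closure_chain:
  assumes chain: "subset.chain {S. irreducible_closed S} C" and "C \<noteq> {}"
  shows "irreducible_closed (zariski_closure (\<Union>C))"
  unfolding irreducible_closed_def
proof (intro conjI allI impI)
  have irr: "irreducible_closed S" if "S \<in> C" for S
    using chain that by (auto simp: subset_chain_def)
  obtain S where "S \<in> C" using \<open>C \<noteq> {}\<close> by auto
  with irr have "S \<noteq> {}" by (auto simp: irreducible_closed_def)
  then show "zariski_closure (\<Union>C) \<noteq> {}"
    using \<open>S \<in> C\<close> subset_zariski_closure[of "\<Union>C"] by auto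
  fix A B
  assume "zariski_closed A \<and> zariski_closed B \<and> zariski_closure (\<Union>C) = A \<union> B"
  then have A: "zariski_closed A" and B: "zariski_closed B"
    and AB: "zariski_closure (\<Union>C) = A \<union> B" by auto
  have "\<Union>C \<subseteq> A \<or> \<Union>C \<subseteq> B"
  proof (rule ccontr)
    assume "\<not> ?thesis"
    then obtain x y X Y where "x \<notin> A" "y \<notin> B" "x \<in> X" "y \<in> Y" "X \<in> C" "Y \<in> C" by auto
    moreover have "X \<subseteq> Y \<or> Y \<subseteq> X"
      using chain \<open>X \<in> C\<close> \<open>Y \<in> C\<close> by (auto simp: subset_chain_def)
    ultimately obtain Z where Z: "Z \<in> C" "x \<in> Z" "y \<in> Z" by auto
    have "Z \<subseteq> A \<union> B" using Z AB subset_zariski_closure[of "\<Union>C"] by auto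
    with irreducible_closed_subset_cases[OF irr[OF Z(1)] A B] Z \<open>x \<notin> A\<close> \<open>y \<notin> B\<close>
    show False by auto
  qed
  then show "zariski_closure (\<Union>C) = A \<or> zariski_closure (\<Union>C) = B"
    using zariski_closure_minimal[OF _ A] zariski_closure_minimal[OF _ B] AB by blast
qed (rule zariski_closed_closure)

text \<open>Zorn's lemma applies to the irreducible closed sets between \<open>Y\<close> and
  \<open>V\<close>. A maximal one is maximal among all irreducible closed subsets of
  \<open>V\<close>, since every set above it contains \<open>Y\<close> as well.\<close>

lemma irreducible_component_exists:
  assumes V: "zariski_closed V" and Y: "irreducible_closed Y" "Y \<subseteq> V"
  obtains Z where "irreducible_component Z V" "Y \<subseteq> Z"
proof -
  let ?A = "{S. irreducible_closed S \<and> Y \<subseteq> S \<and> S \<subseteq> V}"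
  have "\<exists>M\<in>?A. \<forall>X\<in>?A. M \<subseteq> X \<longrightarrow> X = M"
  proof (rule subset_Zorn)
    fix C assume C: "subset.chain ?A C"
    show "\<exists>U\<in>?A. \<forall>X\<in>C. X \<subseteq> U"
    proof (cases "C = {}")
      case True
      then show ?thesis using Y by auto
    next
      case False
      have "subset.chain {S. irreducible_closed S} C"
        using C by (auto simp: subset_chain_def)
      then have "irreducible_closed (zariski_closure (\<Union>C))"
        using False by (rule irreducible_closed_closure_chain)
      moreover have "zariski_closure (\<Union>C) \<subseteq> V"
        using C by (intro zariski_closure_minimal V) (auto simp: subset_chain_def)
      moreover have "Y \<subseteq> \<Union>C"
        using C False unfolding subset_chain_def by blast
      ultimately show ?thesis
        using subset_zariski_closure[of "\<Union>C"]
        by (intro bexI[of _ "zariski_closure (\<Union>C)"]) auto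
    qed
  qed
  then obtain M where "M \<in> ?A" "\<forall>X\<in>?A. M \<subseteq> X \<longrightarrow> X = M" by blast
  then have "irreducible_component M V" "Y \<subseteq> M"
    unfolding irreducible_component_def by auto
  then show thesis by (rule that)
qed


section \<open>Polynomial embeddings of affine space\<close>

definition coord_subspace :: "'v set \<Rightarrow> 'v point set" where
  "coord_subspace F = {x. \<forall>i\<in>-F. x i = 0}"

lemma coord_subspace_mono: "F \<subseteq> G \<Longrightarrow> coord_subspace F \<subseteq> coord_subspace G"
  unfolding coord_subspace_def by blast

text \<open>The polynomial left inverse makes the image closed; irreducibility is inherited from the
  linear space, where any two points are joined by a line.\<close>

lemma irreducible_closed_embedded_subspace:
  fixes \<phi> :: "'a point \<Rightarrow> 'b point" and \<psi> :: "'b point \<Rightarrow> 'a point"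
  assumes \<phi>: "\<And>v. poly_fn (\<lambda>x. \<phi> x v)" and \<psi>: "\<And>t. poly_fn (\<lambda>x. \<psi> x t)"
    and inv: "\<And>s. s \<in> coord_subspace F \<Longrightarrow> \<psi> (\<phi> s) = s"
  shows "irreducible_closed (\<phi> ` coord_subspace F)"
  unfolding irreducible_closed_def
proof (intro conjI allI impI)
  \<comment> \<open>The image consists of the fixed points of \<phi> after \<psi> whose parameters
    vanish outside \<open>F\<close>; both conditions are polynomial.\<close>
  have "\<phi> ` coord_subspace F =
      {x. \<forall>v\<in>UNIV. \<phi> (\<psi> x) v - x v = 0} \<inter> {x. \<forall>t\<in>-F. \<psi> x t = 0}"
  proof (intro equalityI subsetI)
    fix x assume x: "x \<in> {x. \<forall>v\<in>UNIV. \<phi> (\<psi> x) v - x v = 0} \<inter> {x. \<forall>t\<in>-F. \<psi> x t = 0}"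
    then have "x = \<phi> (\<psi> x)" by auto
    moreover have "\<psi> x \<in> coord_subspace F" using x by (auto simp: coord_subspace_def)
    ultimately show "x \<in> \<phi> ` coord_subspace F" by (rule image_eqI)
  qed (auto simp: inv, auto simp: coord_subspace_def)
  moreover have "zariski_closed \<dots>"
    by (intro zariski_closed_Int zariski_closed_zero_set poly_fn_diff
        poly_fn_compose[OF \<phi>] \<psi> poly_fn.coord)
  ultimately show "zariski_closed (\<phi> ` coord_subspace F)" by simp
  have "(\<lambda>_. 0) \<in> coord_subspace F" by (simp add: coord_subspace_def)
  then show "\<phi> ` coord_subspace F \<noteq> {}" by blast
  fix A B
  assume "zariski_closed A \<and> zariski_closed B \<and> \<phi> ` coord_subspace F = A \<union> B"
  then have "zariski_closed A" "zariski_closed B" and AB: "\<phi> ` coord_subspace F = A \<union> B"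
    by auto
  from \<open>zariski_closed A\<close> obtain P where P: "\<forall>f\<in>P. poly_fn f" "A = {x. \<forall>f\<in>P. f x = 0}"
    unfolding zariski_closed_def by blast
  from \<open>zariski_closed B\<close> obtain Q where Q: "\<forall>f\<in>Q. poly_fn f" "B = {x. \<forall>f\<in>Q. f x = 0}"
    unfolding zariski_closed_def by blast
  show "\<phi> ` coord_subspace F = A \<or> \<phi> ` coord_subspace F = B"
  proof (rule ccontr)
    assume "\<not> ?thesis"
    then obtain x y where xy: "x \<in> coord_subspace F" "y \<in> coord_subspace F"
      "\<phi> x \<notin> A" "\<phi> y \<notin> B" using AB by blast
    then obtain f g where f: "f \<in> P" "f (\<phi> x) \<noteq> 0" and g: "g \<in> Q" "g (\<phi> y) \<noteq> 0"
      using P(2) Q(2) by auto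
    \<comment> \<open>The line through \<open>x\<close> (at \<open>t = 0\<close>) and
      \<open>y\<close> (at \<open>t = 1\<close>). Pulled back to it, \<open>f\<close> and
      \<open>g\<close> are nonzero polynomials in \<open>t\<close>, so some \<open>t\<close> avoids
      the roots of both.\<close>
    let ?l = "\<lambda>t i. x i + t * (y i - x i)"
    have "poly_fn (\<lambda>s. f (\<phi> s))" "poly_fn (\<lambda>s. g (\<phi> s))"
      using P(1) Q(1) f g \<phi> by (auto intro: poly_fn_compose)
    from this[THEN poly_fn_on_line, of x "\<lambda>i. y i - x i"]
    obtain a b where a: "\<And>t. f (\<phi> (?l t)) = poly a t" and b: "\<And>t. g (\<phi> (?l t)) = poly b t"
      by blast
    have "poly a 0 \<noteq> 0" "poly b 1 \<noteq> 0"
      using a[of 0] b[of 1] f g by simp_all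
    then have "a * b \<noteq> 0" by auto
    then have "finite {t. poly (a * b) t = 0}" by (rule poly_roots_finite)
    then obtain t where t: "poly (a * b) t \<noteq> 0"
      using infinite_UNIV_char_0 by (metis (mono_tags, lifting) UNIV_eq_I mem_Collect_eq)
    have "?l t \<in> coord_subspace F" using xy by (auto simp: coord_subspace_def)
    then have "\<phi> (?l t) \<in> A \<union> B" using AB by blast
    moreover have "f (\<phi> (?l t)) \<noteq> 0" "g (\<phi> (?l t)) \<noteq> 0" using t a b by auto
    ultimately show False using P(2) Q(2) f g by blast
  qed
qed

section \<open>Dimension bounds from embedded coordinate subspaces\<close>

lemma variety_dim_mono:
  assumes "S \<subseteq> T"
  shows "variety_dim S \<le> variety_dim T"
  unfolding variety_dim_def by (rule Sup_subset_mono) (use assms in blast)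

text \<open>Freeing the coordinates in \<open>F\<close> one at a time gives a flag of coordinate
  subspaces; its image is a chain of length \<open>card F\<close>, strict because \<psi> makes
  \<phi> injective on \<open>coord_subspace F\<close>.\<close>

lemma variety_dim_embedded_subspace:
  fixes \<phi> :: "'a point \<Rightarrow> 'b point" and \<psi> :: "'b point \<Rightarrow> 'a point"
  assumes \<phi>: "\<And>v. poly_fn (\<lambda>x. \<phi> x v)" and \<psi>: "\<And>t. poly_fn (\<lambda>x. \<psi> x t)"
    and inv: "\<And>s. s \<in> coord_subspace F \<Longrightarrow> \<psi> (\<phi> s) = s"
    and "finite F"
  shows "enat (card F) \<le> variety_dim (\<phi> ` coord_subspace F)"
proof -
  obtain e where e: "bij_betw e {0..<card F} F"
    using \<open>finite F\<close> ex_bij_betw_nat_finite by blast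
  define C where "C k = \<phi> ` coord_subspace (e ` {0..<k})" for k
  have sub: "coord_subspace (e ` {0..<k}) \<subseteq> coord_subspace F" if "k \<le> card F" for k
  proof -
    have "e ` {0..<k} \<subseteq> F" using e that by (auto simp: bij_betw_def)
    then show ?thesis by (rule coord_subspace_mono)
  qed
  have "irreducible_closed (C k) \<and> C k \<subseteq> \<phi> ` coord_subspace F" if "k \<le> card F" for k
    unfolding C_def
    by (intro conjI irreducible_closed_embedded_subspace[where \<psi> = \<psi>] image_mono sub that)
      (use \<phi> \<psi> inv sub[OF that] in auto)
  moreover have "C k \<subset> C (Suc k)" if k: "k < card F" for k
  proof
    show "C k \<subseteq> C (Suc k)"
      unfolding C_def by (intro image_mono coord_subspace_mono) auto
    \<comment> \<open>The unit vector of the coordinate that is freed at step \<open>k\<close>; its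
      image separates the two sets.\<close>
    define s :: "'a point" where "s = (\<lambda>t. of_bool (t = e k))"
    have s: "s \<in> coord_subspace (e ` {0..<Suc k})"
      by (auto simp: s_def coord_subspace_def)
    have "inj_on e {0..<card F}" using e by (simp add: bij_betw_def)
    then have "e k \<notin> e ` {0..<k}"
      using k by (auto dest!: inj_onD)
    then have "s \<notin> coord_subspace (e ` {0..<k})"
      by (auto simp: s_def coord_subspace_def)
    then have "\<phi> s \<notin> C k"
      using inv s sub[of k] sub[of "Suc k"] k unfolding C_def
      by (smt (verit) Suc_leI imageE less_imp_le subsetD)
    moreover have "\<phi> s \<in> C (Suc k)" using s unfolding C_def by blast
    ultimately show "C k \<noteq> C (Suc k)" by blast
  qed
  ultimately show ?thesis
    unfolding variety_dim_def by (intro Sup_upper) blast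
qed

text \<open>The image is irreducible, so one component of \<open>V\<close> contains all of it, and
  with it \<open>q\<close>.\<close>

lemma local_dim_ge_embedded_subspace:
  fixes \<phi> :: "'a point \<Rightarrow> 'b point" and \<psi> :: "'b point \<Rightarrow> 'a point"
  assumes \<phi>: "\<And>v. poly_fn (\<lambda>x. \<phi> x v)" and \<psi>: "\<And>t. poly_fn (\<lambda>x. \<psi> x t)"
    and inv: "\<And>s. s \<in> coord_subspace F \<Longrightarrow> \<psi> (\<phi> s) = s"
    and "finite F" "zariski_closed V" "\<phi> ` coord_subspace F \<subseteq> V" "q \<in> \<phi> ` coord_subspace F"
  shows "enat (card F) \<le> local_dim V q"
proof -
  have "irreducible_closed (\<phi> ` coord_subspace F)"
    by (rule irreducible_closed_embedded_subspace[where \<psi> = \<psi>]) (use \<phi> \<psi> inv in auto)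
  then obtain Z where Z: "irreducible_component Z V" "\<phi> ` coord_subspace F \<subseteq> Z"
    using irreducible_component_exists[OF \<open>zariski_closed V\<close>] assms(6) by blast
  have "enat (card F) \<le> variety_dim (\<phi> ` coord_subspace F)"
    by (rule variety_dim_embedded_subspace[where \<psi> = \<psi>]) (use assms in auto)
  also have "\<dots> \<le> variety_dim Z" by (rule variety_dim_mono) (rule Z(2))
  also have "\<dots> \<le> local_dim V q"
    unfolding local_dim_def by (intro Sup_upper imageI) (use Z assms(7) in auto)
  finally show ?thesis .
qed


section \<open>Products of unitriangular matrices\<close>

text \<open>The function \<open>h\<close> orders the index type; it is injective in all uses.\<close>

definition lower_unitri :: "('a \<Rightarrow> nat) \<Rightarrow> ('a \<times> 'a) point \<Rightarrow> complex^'a^'a" where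
  "lower_unitri h s = (\<chi> i j. if i = j then 1 else if h j < h i then s (i, j) else 0)"

text \<open>The two factors read \<open>s\<close> on opposite sides of the diagonal, so a single
  \<open>s\<close> holds the parameters of both.\<close>

definition upper_unitri :: "('a \<Rightarrow> nat) \<Rightarrow> ('a \<times> 'a) point \<Rightarrow> complex^'a^'a" where
  "upper_unitri h s = (\<chi> i j. if i = j then 1 else if h i < h j then s (i, j) else 0)"

text \<open>The recursion is forward substitution in the equation \<open>L M = 1\<close>.\<close>

function lower_inv_entry ::
    "('a::finite \<Rightarrow> nat) \<Rightarrow> ('a \<times> 'a) point \<Rightarrow> 'a \<Rightarrow> 'a \<Rightarrow> complex" where
  "lower_inv_entry h s i j =
     of_bool (i = j) - (\<Sum>k\<in>{k. h k < h i}. s (i, k) * lower_inv_entry h s k j)"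
  by pat_completeness auto
termination
  by (relation "Wellfounded.measure (\<lambda>(h, s, i, j). h i)") auto

declare lower_inv_entry.simps [simp del]

definition lower_inv :: "('a::finite \<Rightarrow> nat) \<Rightarrow> ('a \<times> 'a) point \<Rightarrow> complex^'a^'a" where
  "lower_inv h s = (\<chi> i j. lower_inv_entry h s i j)"

text \<open>Transposition exchanges the two kinds of unitriangular matrix, and swapping the index
  pairs of \<open>s\<close> matches their parameters.\<close>

definition upper_inv :: "('a::finite \<Rightarrow> nat) \<Rightarrow> ('a \<times> 'a) point \<Rightarrow> complex^'a^'a" where
  "upper_inv h s = transpose (lower_inv h (s \<circ> prod.swap))"

text \<open>Forward substitution never divides, because the diagonal entries are 1.\<close>

lemma poly_fn_lower_inv: "poly_fn (\<lambda>s. lower_inv h s $ i $ j)"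
proof -
  have "poly_fn (\<lambda>s. lower_inv_entry h s i j)"
  proof (induction "h i" arbitrary: i rule: less_induct)
    case less
    show ?case
      by (subst lower_inv_entry.simps)
        (intro poly_fn_diff poly_fn_sum poly_fn.intros less; simp)
  qed
  then show ?thesis by (simp add: lower_inv_def)
qed

lemma poly_fn_upper_inv: "poly_fn (\<lambda>s. upper_inv h s $ i $ j)"
  unfolding upper_inv_def transpose_def vec_lambda_beta
  by (rule poly_fn_compose[OF poly_fn_lower_inv]) (simp add: poly_fn.coord)

lemma lower_inv_entry_above_diagonal:
  "h i < h j \<Longrightarrow> lower_inv_entry h s i j = 0"
proof (induction "h i" arbitrary: i rule: less_induct)
  case less
  then have "(\<Sum>k\<in>{k. h k < h i}. s (i, k) * lower_inv_entry h s k j) = 0"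
    by (intro sum.neutral) auto
  then show ?case using less by (subst lower_inv_entry.simps) auto
qed

lemma lower_inv_entry_diagonal: "lower_inv_entry h s i i = 1"
  by (subst lower_inv_entry.simps) (simp add: lower_inv_entry_above_diagonal)

text \<open>Row \<open>i\<close> of the lower factor is supported on \<open>i\<close> and the
  indices before it, so the product entry is the defining recursion solved for
  \<open>of_bool (i = j)\<close>.\<close>

lemma lower_unitri_mult_lower_inv:
  assumes "inj h"
  shows "lower_unitri h s ** lower_inv h s = mat 1"
proof -
  have "(lower_unitri h s ** lower_inv h s) $ i $ j = mat 1 $ i $ j" for i j
  proof -
    let ?f = "\<lambda>k. lower_unitri h s $ i $ k * lower_inv_entry h s k j"
    have "(\<Sum>k\<in>UNIV. ?f k) = (\<Sum>k\<in>insert i {k. h k < h i}. ?f k)"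
      by (rule sum.mono_neutral_right) (auto simp: lower_unitri_def)
    also have "\<dots> = lower_inv_entry h s i j + (\<Sum>k\<in>{k. h k < h i}. ?f k)"
      by (subst sum.insert) (auto simp: lower_unitri_def)
    also have "(\<Sum>k\<in>{k. h k < h i}. ?f k) =
        (\<Sum>k\<in>{k. h k < h i}. s (i, k) * lower_inv_entry h s k j)"
      by (rule sum.cong) (auto simp: lower_unitri_def)
    also have "lower_inv_entry h s i j + \<dots> = of_bool (i = j)"
      by (subst lower_inv_entry.simps) simp
    finally show ?thesis
      by (simp add: matrix_matrix_mult_def lower_inv_def mat_def)
  qed
  then show ?thesis by (simp add: vec_eq_iff)
qed

lemma upper_inv_mult_upper_unitri:
  assumes "inj h"
  shows "upper_inv h s ** upper_unitri h s = mat 1"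
proof -
  have "upper_unitri h s = transpose (lower_unitri h (s \<circ> prod.swap))"
    by (auto simp: upper_unitri_def lower_unitri_def transpose_def vec_eq_iff)
  then show ?thesis
    by (simp add: upper_inv_def matrix_transpose_mul[symmetric]
        lower_unitri_mult_lower_inv[OF assms] transpose_mat)
qed

section \<open>Products of a lower and an upper factor, and recovery of the parameters\<close>

definition lu_mat :: "('a::finite \<Rightarrow> nat) \<Rightarrow> ('a \<times> 'a) point \<Rightarrow> complex^'a^'a" where
  "lu_mat h s = lower_unitri h s ** upper_unitri h s"

definition lu_inv :: "('a::finite \<Rightarrow> nat) \<Rightarrow> ('a \<times> 'a) point \<Rightarrow> complex^'a^'a" where
  "lu_inv h s = upper_inv h s ** lower_inv h s"

lemma poly_fn_lu_mat: "poly_fn (\<lambda>s. lu_mat h s $ i $ j)"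
proof -
  have "poly_fn (\<lambda>s. lower_unitri h s $ i $ j)" "poly_fn (\<lambda>s. upper_unitri h s $ i $ j)" for i j
    by (cases "i = j"; cases "h i < h j"; cases "h j < h i";
        simp add: lower_unitri_def upper_unitri_def poly_fn.const poly_fn.coord)+
  then show ?thesis
    by (auto simp: lu_mat_def matrix_matrix_mult_def intro!: poly_fn_sum poly_fn.mult)
qed

lemma poly_fn_lu_inv: "poly_fn (\<lambda>s. lu_inv h s $ i $ j)"
  by (auto simp: lu_inv_def matrix_matrix_mult_def
      intro!: poly_fn_sum poly_fn.mult poly_fn_lower_inv poly_fn_upper_inv)

lemma lu_mat_mult_lu_inv:
  assumes "inj h"
  shows "lu_mat h s ** lu_inv h s = mat 1"
proof -
  have "upper_unitri h s ** upper_inv h s = mat 1"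
    using upper_inv_mult_upper_unitri[OF assms] matrix_left_right_inverse by blast
  then show ?thesis
    using lower_unitri_mult_lower_inv[OF assms]
    by (metis lu_inv_def lu_mat_def matrix_mul_assoc matrix_mul_rid)
qed

lemma lu_mat_0: "lu_mat h (\<lambda>_. 0) = mat 1"
proof -
  have "lower_unitri h (\<lambda>_. 0) = mat 1" "upper_unitri h (\<lambda>_. 0) = mat 1"
    by (auto simp: lower_unitri_def upper_unitri_def mat_def vec_eq_iff)
  then show ?thesis by (simp add: lu_mat_def)
qed

lemma lu_inv_0: "inj h \<Longrightarrow> lu_inv h (\<lambda>_. 0) = mat 1"
  using lu_mat_mult_lu_inv[of h "\<lambda>_. 0"] by (simp add: lu_mat_0)

text \<open>The last row of the inverse upper factor and the last column of the inverse lower factor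
  have only their diagonal entry. This 1 later serves as the known factor when entries of a group
  element are read off the orbit.\<close>

lemma lu_inv_last_diagonal:
  assumes "inj h" and l: "\<And>k. h k \<le> h l"
  shows "lu_inv h s $ l $ l = 1"
proof -
  have "lu_inv h s $ l $ l =
      (\<Sum>k\<in>UNIV. lower_inv_entry h (s \<circ> prod.swap) k l * lower_inv_entry h s k l)"
    by (simp add: lu_inv_def upper_inv_def lower_inv_def matrix_matrix_mult_def transpose_def)
  also have "\<dots> = (\<Sum>k\<in>{l}. lower_inv_entry h (s \<circ> prod.swap) k l * lower_inv_entry h s k l)"
  proof (rule sum.mono_neutral_right)
    have "h k < h l" if "k \<noteq> l" for k
      using that l[of k] \<open>inj h\<close> by (metis injD le_neq_implies_less)
    then show "\<forall>k\<in>UNIV - {l}. lower_inv_entry h (s \<circ> prod.swap) k l * lower_inv_entry h s k l = 0"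
      by (auto simp: lower_inv_entry_above_diagonal)
  qed auto
  also have "\<dots> = 1" by (simp add: lower_inv_entry_diagonal)
  finally show ?thesis .
qed

lemma lu_mat_off_diagonal:
  assumes "inj h" "i \<noteq> j"
  shows "lu_mat h s $ i $ j =
    s (i, j) + (\<Sum>k\<in>{k. h k < min (h i) (h j)}. s (i, k) * s (k, j))"
proof -
  let ?f = "\<lambda>k. lower_unitri h s $ i $ k * upper_unitri h s $ k $ j"
  \<comment> \<open>The earlier of \<open>i\<close> and \<open>j\<close>: at \<open>k = d\<close>
    one factor is a diagonal 1 and the other is \<open>s (i, j)\<close>. Terms with \<open>k\<close>
    after \<open>d\<close> vanish.\<close>
  define d where "d = (if h i < h j then i else j)"
  have ne: "h i \<noteq> h j" using assms by (auto dest: injD)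
  have "(\<Sum>k\<in>UNIV. ?f k) = (\<Sum>k\<in>insert d {k. h k < min (h i) (h j)}. ?f k)"
    by (rule sum.mono_neutral_right)
      (use ne \<open>inj h\<close> in \<open>auto simp: lower_unitri_def upper_unitri_def d_def split: if_splits\<close>)
  also have "\<dots> = ?f d + (\<Sum>k\<in>{k. h k < min (h i) (h j)}. ?f k)"
    by (subst sum.insert) (auto simp: d_def)
  also have "?f d = s (i, j)"
    using ne assms by (auto simp: lower_unitri_def upper_unitri_def d_def)
  also have "(\<Sum>k\<in>{k. h k < min (h i) (h j)}. ?f k) =
      (\<Sum>k\<in>{k. h k < min (h i) (h j)}. s (i, k) * s (k, j))"
    by (rule sum.cong) (auto simp: lower_unitri_def upper_unitri_def)
  finally show ?thesis by (simp add: lu_mat_def matrix_matrix_mult_def)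
qed

text \<open>Gaussian elimination without division: by \<open>lu_mat_off_diagonal\<close>,
  \<open>s (i, j)\<close> is a matrix entry minus products of parameters whose smaller index comes
  earlier, which are already recovered.\<close>

lemma lu_mat_recover:
  assumes "inj h"
  shows "i \<noteq> j \<Longrightarrow> \<exists>g. poly_fn g \<and> (\<forall>s. g (\<lambda>(k, l). lu_mat h s $ k $ l) = s (i, j))"
proof (induction "min (h i) (h j)" arbitrary: i j rule: less_induct)
  case less
  let ?K = "{k. h k < min (h i) (h j)}"
  let ?M = "\<lambda>s (k, l). lu_mat h s $ k $ l"
  have "\<exists>g. poly_fn g \<and> (\<forall>s. g (?M s) = s (i, k))" if "k \<in> ?K" for k
    using that by (intro less(1)) auto
  then obtain g1 where g1: "\<And>k. k \<in> ?K \<Longrightarrow> poly_fn (g1 k)"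
      "\<And>k s. k \<in> ?K \<Longrightarrow> g1 k (?M s) = s (i, k)" by metis
  have "\<exists>g. poly_fn g \<and> (\<forall>s. g (?M s) = s (k, j))" if "k \<in> ?K" for k
    using that by (intro less(1)) auto
  then obtain g2 where g2: "\<And>k. k \<in> ?K \<Longrightarrow> poly_fn (g2 k)"
      "\<And>k s. k \<in> ?K \<Longrightarrow> g2 k (?M s) = s (k, j)" by metis
  let ?g = "\<lambda>x. x (i, j) - (\<Sum>k\<in>?K. g1 k x * g2 k x)"
  have "poly_fn ?g"
    by (intro poly_fn_diff poly_fn_sum poly_fn.mult poly_fn.coord g1 g2)
  moreover have "?g (?M s) = s (i, j)" for s
  proof -
    have "(\<Sum>k\<in>?K. g1 k (?M s) * g2 k (?M s)) = (\<Sum>k\<in>?K. s (i, k) * s (k, j))"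
      by (intro sum.cong refl) (simp only: g1(2) g2(2))
    then show ?thesis using lu_mat_off_diagonal[OF assms less(2), of s] by simp
  qed
  ultimately show ?case by blast
qed

definition off_diagonal :: "('a \<times> 'a) set" where
  "off_diagonal = {(i, j). i \<noteq> j}"

lemma card_off_diagonal: "card (off_diagonal :: ('a::finite \<times> 'a) set) + CARD('a) = CARD('a)\<^sup>2"
proof -
  have "off_diagonal \<union> range (\<lambda>i::'a. (i, i)) = UNIV"
    by (auto simp: off_diagonal_def)
  moreover have "card (off_diagonal \<union> range (\<lambda>i::'a. (i, i))) =
      card (off_diagonal :: ('a \<times> 'a) set) + card (range (\<lambda>i::'a. (i, i)))"
    by (rule card_Un_disjoint) (auto simp: off_diagonal_def)
  moreover have "card (range (\<lambda>i::'a. (i, i))) = CARD('a)"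
    by (rule card_image) (auto simp: inj_on_def)
  ultimately show ?thesis
    by (simp add: power2_eq_square flip: UNIV_Times_UNIV)
qed

text \<open>Collects what the orbit argument uses: \<open>A\<close> and \<open>B\<close> are the LU
  products and their inverses, \<open>l\<close> is the last index, and \<open>g\<close> recovers the
  parameters.\<close>

lemma polynomial_matrix_family:
  obtains A B :: "('a::finite \<times> 'a) point \<Rightarrow> complex^'a^'a" and l :: 'a
    and g :: "('a \<times> 'a) point \<Rightarrow> ('a \<times> 'a) point"
  where "\<And>i j. poly_fn (\<lambda>s. A s $ i $ j)" "\<And>i j. poly_fn (\<lambda>s. B s $ i $ j)"
    "\<And>s. A s ** B s = mat 1" "A (\<lambda>_. 0) = mat 1" "B (\<lambda>_. 0) = mat 1"
    "\<And>s. B s $ l $ l = 1" "\<And>t. poly_fn (\<lambda>x. g x t)"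
    "\<And>s. s \<in> coord_subspace off_diagonal \<Longrightarrow> g (\<lambda>(i, j). A s $ i $ j) = s"
proof -
  obtain h :: "'a \<Rightarrow> nat" where h: "inj h"
    using finite_imp_inj_to_nat_seg[OF finite[of "UNIV :: 'a set"]] by auto
  obtain l where l: "\<And>k. h k \<le> h l"
  proof -
    have "Max (range h) \<in> range h" by (rule Max_in) auto
    then obtain l where "Max (range h) = h l" by (rule imageE)
    then have "h k \<le> h l" for k by (metis Max_ge finite finite_imageI rangeI)
    then show thesis by (rule that)
  qed
  \<comment> \<open>Diagonal parameters do not enter the matrices; the value 0 is returned for them,
    as \<open>coord_subspace off_diagonal\<close> prescribes.\<close>
  have "\<exists>g. poly_fn g \<and> (t \<in> off_diagonal \<longrightarrow> (\<forall>s. g (\<lambda>(i, j). lu_mat h s $ i $ j) = s t)) \<and>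
      (t \<notin> off_diagonal \<longrightarrow> (\<forall>x. g x = 0))" for t
  proof (cases "t \<in> off_diagonal")
    case True
    then show ?thesis
      using lu_mat_recover[OF h, of "fst t" "snd t"] by (auto simp: off_diagonal_def)
  next
    case False
    then show ?thesis by (intro exI[of _ "\<lambda>_. 0"]) (simp add: poly_fn.const)
  qed
  then obtain G where G: "\<And>t. poly_fn (G t)"
    "\<And>t s. t \<in> off_diagonal \<Longrightarrow> G t (\<lambda>(i, j). lu_mat h s $ i $ j) = s t"
    "\<And>t x. t \<notin> off_diagonal \<Longrightarrow> G t x = 0" by metis
  have "(\<lambda>t. G t (\<lambda>(i, j). lu_mat h s $ i $ j)) = s" if "s \<in> coord_subspace off_diagonal" for s
  proof
    fix t
    show "G t (\<lambda>(i, j). lu_mat h s $ i $ j) = s t"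
      using that G(2,3) by (cases "t \<in> off_diagonal") (auto simp: coord_subspace_def)
  qed
  with that[of "lu_mat h" "lu_inv h" l "\<lambda>x t. G t x"] show thesis
    using poly_fn_lu_mat poly_fn_lu_inv lu_mat_mult_lu_inv[OF h] lu_mat_0 lu_inv_0[OF h]
      lu_inv_last_diagonal[OF h l] G(1) by blast
qed


section \<open>The group action on solutions of the Brent equations\<close>

lemma zariski_closed_brent_variety: "zariski_closed brent_variety"
proof -
  let ?f = "\<lambda>(i1, i2, j1, j2, k1, k2) q.
     (\<Sum>i\<in>UNIV. q (Alpha i i1 i2) * q (Beta i j1 j2) * q (Gamma i k1 k2)) -
     of_bool (i2 = j1) * of_bool (j2 = k1) * of_bool (k2 = i1)"
  have "brent_variety = {q. \<forall>t\<in>UNIV. ?f t q = 0}"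
    by (auto simp: brent_variety_def)
  also have "zariski_closed \<dots>"
  proof (rule zariski_closed_zero_set)
    fix t
    show "poly_fn (?f t)"
      by (cases t) (auto intro!: poly_fn_diff poly_fn_sum poly_fn.intros)
  qed
  finally show ?thesis .
qed

lemma brent_varietyD:
  assumes "q \<in> brent_variety"
  shows "(\<Sum>i\<in>UNIV. q (Alpha i i1 i2) * q (Beta i j1 j2) * q (Gamma i k1 k2)) =
     of_bool (i2 = j1) * of_bool (j2 = k1) * of_bool (k2 = i1)"
  using assms by (simp add: brent_variety_def)

text \<open>Here \<open>a', b', c'\<close> play the roles of the inverses of \<open>a, b, c\<close>.\<close>

fun brent_act ::
    "complex^'m^'m \<Rightarrow> complex^'m^'m \<Rightarrow> complex^'n^'n \<Rightarrow> complex^'n^'n \<Rightarrow>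
     complex^'p^'p \<Rightarrow> complex^'p^'p \<Rightarrow> ('m::finite, 'n::finite, 'p::finite, 'r) brent_unknown point \<Rightarrow>
     ('m, 'n, 'p, 'r) brent_unknown point" where
  "brent_act a a' b b' c c' q (Alpha i x y) = (\<Sum>(j, k)\<in>UNIV. a $ x $ j * b' $ k $ y * q (Alpha i j k))"
| "brent_act a a' b b' c c' q (Beta i x y) = (\<Sum>(j, k)\<in>UNIV. b $ x $ j * c' $ k $ y * q (Beta i j k))"
| "brent_act a a' b b' c c' q (Gamma i x y) = (\<Sum>(j, k)\<in>UNIV. c $ x $ j * a' $ k $ y * q (Gamma i j k))"

section \<open>Invariance of the Brent equations under the action\<close>

lemma sum_UNIV_prod:
  "(\<Sum>t\<in>UNIV. f t) = (\<Sum>x\<in>UNIV. \<Sum>y\<in>UNIV. f (x, y))"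
  by (simp add: sum.cartesian_product)

lemma sum_triple_product:
  fixes f g h :: "_ \<Rightarrow> 'c::comm_semiring_1"
  shows "(\<Sum>x\<in>X. f x) * (\<Sum>y\<in>Y. g y) * (\<Sum>z\<in>Z. h z) = (\<Sum>x\<in>X. \<Sum>y\<in>Y. \<Sum>z\<in>Z. f x * g y * h z)"
proof -
  have "(\<Sum>x\<in>X. f x) * (\<Sum>y\<in>Y. g y) * (\<Sum>z\<in>Z. h z) =
      (\<Sum>x\<in>X. f x * (\<Sum>y\<in>Y. g y * (\<Sum>z\<in>Z. h z)))"
    by (simp only: sum_distrib_right mult.assoc)
  then show ?thesis by (simp only: sum_distrib_left mult.assoc)
qed

text \<open>Trilinearity: the coefficients of the action move outside, leaving the sum over
  \<open>i\<close> to which the Brent equations of \<open>q\<close> apply.\<close>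

lemma sum_triple_product_combination:
  fixes f g h :: "_ \<Rightarrow> 'c::comm_semiring_1"
  shows "(\<Sum>i\<in>I. (\<Sum>x\<in>X. f x * u i x) * (\<Sum>y\<in>Y. g y * v i y) * (\<Sum>z\<in>Z. h z * w i z)) =
    (\<Sum>x\<in>X. \<Sum>y\<in>Y. \<Sum>z\<in>Z. f x * g y * h z * (\<Sum>i\<in>I. u i x * v i y * w i z))"
proof -
  have "(\<Sum>i\<in>I. (\<Sum>x\<in>X. f x * u i x) * (\<Sum>y\<in>Y. g y * v i y) * (\<Sum>z\<in>Z. h z * w i z)) =
      (\<Sum>i\<in>I. \<Sum>x\<in>X. \<Sum>y\<in>Y. \<Sum>z\<in>Z. f x * g y * h z * (u i x * v i y * w i z))"
    unfolding sum_triple_product by (intro sum.cong refl) (simp only: mult_ac)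
  also have "\<dots> = (\<Sum>x\<in>X. \<Sum>y\<in>Y. \<Sum>z\<in>Z. \<Sum>i\<in>I. f x * g y * h z * (u i x * v i y * w i z))"
    by (subst sum.swap, rule sum.cong[OF refl], subst sum.swap, rule sum.cong[OF refl], rule sum.swap)
  finally show ?thesis by (simp only: sum_distrib_left)
qed

lemma brent_act_in_variety:
  fixes a a' :: "complex^'m::finite^'m" and b b' :: "complex^'n::finite^'n"
    and c c' :: "complex^'p::finite^'p"
    and q :: "('m, 'n, 'p, 'r::finite) brent_unknown point"
  assumes q: "q \<in> brent_variety"
    and a: "a ** a' = mat 1" and b: "b ** b' = mat 1" and c: "c ** c' = mat 1"
  shows "brent_act a a' b b' c c' q \<in> brent_variety"
  unfolding brent_variety_def mem_Collect_eq
proof (intro allI)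
  fix i1 k2 :: 'm and i2 j1 :: 'n and j2 k1 :: 'p
  let ?q = "brent_act a a' b b' c c' q"
  have "(\<Sum>i\<in>UNIV. ?q (Alpha i i1 i2) * ?q (Beta i j1 j2) * ?q (Gamma i k1 k2)) =
    (\<Sum>x\<in>UNIV. \<Sum>y\<in>UNIV. \<Sum>z\<in>UNIV.
      (a $ i1 $ fst x * b' $ snd x $ i2) * (b $ j1 $ fst y * c' $ snd y $ j2) *
      (c $ k1 $ fst z * a' $ snd z $ k2) *
      (\<Sum>i\<in>UNIV. q (Alpha i (fst x) (snd x)) * q (Beta i (fst y) (snd y)) * q (Gamma i (fst z) (snd z))))"
    by (simp only: brent_act.simps case_prod_unfold sum_triple_product_combination)
  \<comment> \<open>The three Kronecker deltas are nested in the order in which the sums over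
    \<open>z2\<close>, \<open>z1\<close> and \<open>y1\<close> collapse.\<close>
  also have "\<dots> = (\<Sum>x1\<in>UNIV. \<Sum>x2\<in>UNIV. \<Sum>y1\<in>UNIV. \<Sum>y2\<in>UNIV. \<Sum>z1\<in>UNIV. \<Sum>z2\<in>UNIV.
      if z2 = x1 then if z1 = y2 then if y1 = x2 then
      (a $ i1 $ x1 * b' $ x2 $ i2) * (b $ j1 $ y1 * c' $ y2 $ j2) * (c $ k1 $ z1 * a' $ z2 $ k2)
      else 0 else 0 else 0)"
    unfolding brent_varietyD[OF q] sum_UNIV_prod fst_conv snd_conv
    by (intro sum.cong refl) simp
  also have "\<dots> = (\<Sum>x1\<in>UNIV. \<Sum>x2\<in>UNIV. \<Sum>y2\<in>UNIV.
      (a $ i1 $ x1 * b' $ x2 $ i2) * (b $ j1 $ x2 * c' $ y2 $ j2) * (c $ k1 $ y2 * a' $ x1 $ k2))"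
  proof -
    \<comment> \<open>The condition \<open>y1 = x2\<close> has to leave the sum over
      \<open>y2\<close> before the sum over \<open>y1\<close> can collapse.\<close>
    have if_out: "(\<Sum>y\<in>UNIV. if Q then f y else 0) = (if Q then \<Sum>y\<in>UNIV. f y else 0)"
      for Q and f :: "'p \<Rightarrow> complex" by simp
    show ?thesis
      by (simp only: sum.delta[OF finite] UNIV_I if_True if_out)
  qed
  \<comment> \<open>The remaining indices separate: \<open>x1\<close> contracts \<open>a\<close>
    with \<open>a'\<close>, \<open>x2\<close> contracts \<open>b\<close> with \<open>b'\<close>, and
    \<open>y2\<close> contracts \<open>c\<close> with \<open>c'\<close>.\<close>
  also have "\<dots> = (a ** a') $ i1 $ k2 * (b ** b') $ j1 $ i2 * (c ** c') $ k1 $ j2"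
    unfolding matrix_matrix_mult_def vec_lambda_beta sum_triple_product
    by (intro sum.cong refl) (simp only: mult_ac)
  also have "\<dots> = of_bool (i2 = j1) * of_bool (j2 = k1) * of_bool (k2 = i1)"
    by (auto simp: a b c mat_def)
  finally show "(\<Sum>i\<in>UNIV. ?q (Alpha i i1 i2) * ?q (Beta i j1 j2) * ?q (Gamma i k1 k2)) =
      of_bool (i2 = j1) * of_bool (j2 = k1) * of_bool (k2 = i1)" .
qed

text \<open>
  By the Brent equations, the coefficients \<open>\<beta>\<^sub>j\<^sub>z \<gamma>\<^sub>z\<^sub>k\<close> combine the \<open>u\<^sub>i\<close> into a matrix unit.
\<close>

lemma brent_act_entries:
  fixes a a' :: "complex^'m::finite^'m" and b b' :: "complex^'n::finite^'n"
    and c c' :: "complex^'p::finite^'p"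
    and q :: "('m, 'n, 'p, 'r::finite) brent_unknown point"
  assumes q: "q \<in> brent_variety"
  defines "P \<equiv> brent_act a a' b b' c c' q"
  shows "(\<Sum>i\<in>UNIV. P (Alpha i x1 y1) * (q (Beta i j1 z1) * q (Gamma i z1 k1))) = a $ x1 $ k1 * b' $ j1 $ y1"
    and "(\<Sum>i\<in>UNIV. P (Beta i x2 y2) * (q (Gamma i j2 z2) * q (Alpha i z2 k2))) = b $ x2 $ k2 * c' $ j2 $ y2"
    and "(\<Sum>i\<in>UNIV. P (Gamma i x3 y3) * (q (Alpha i j3 z3) * q (Beta i z3 k3))) = c $ x3 $ k3 * a' $ j3 $ y3"
proof -
  have *: "(\<Sum>i\<in>UNIV. (\<Sum>(j, k)\<in>UNIV. f j k * u i j k) * w i) =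
      (\<Sum>j\<in>UNIV. \<Sum>k\<in>UNIV. f j k * (\<Sum>i\<in>UNIV. u i j k * w i))"
    for f :: "'x::finite \<Rightarrow> 'y::finite \<Rightarrow> complex" and u and w :: "'z::finite \<Rightarrow> complex"
  proof -
    have "(\<Sum>i\<in>UNIV. (\<Sum>t\<in>UNIV. f (fst t) (snd t) * u i (fst t) (snd t)) * w i) =
        (\<Sum>t\<in>UNIV. \<Sum>i\<in>UNIV. f (fst t) (snd t) * u i (fst t) (snd t) * w i)"
      unfolding sum_distrib_right by (rule sum.swap)
    then show ?thesis
      by (simp only: case_prod_unfold sum_UNIV_prod fst_conv snd_conv sum_distrib_left mult.assoc)
  qed
  have delta: "(\<Sum>j\<in>UNIV. \<Sum>k\<in>UNIV. f j k * (of_bool (k = k0) * of_bool (j = j0))) = f j0 k0"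
    for f :: "'x::finite \<Rightarrow> 'y::finite \<Rightarrow> complex" and j0 k0
  proof -
    have "(\<Sum>k\<in>UNIV. f j k * (of_bool (k = k0) * of_bool (j = j0))) =
        (if j = j0 then f j0 k0 else 0)" for j
      by (cases "j = j0") (simp_all add: of_bool_def if_distrib[of "\<lambda>x. _ * x"] cong: if_cong)
    then show ?thesis by simp
  qed
  \<comment> \<open>Using \<open>z1\<close> for both adjacent indices makes one delta equal to 1;
    the remaining two pick out a single entry. The other two cases are its cyclic shifts.\<close>
  have 1: "(\<Sum>i\<in>UNIV. q (Alpha i j k) * (q (Beta i j1 z1) * q (Gamma i z1 k1))) =
      of_bool (k = j1) * of_bool (j = k1)" for j k
    using brent_varietyD[OF q, of j k j1 z1 z1 k1] by (auto simp: mult.assoc)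
  have 2: "(\<Sum>i\<in>UNIV. q (Beta i j k) * (q (Gamma i j2 z2) * q (Alpha i z2 k2))) =
      of_bool (k = j2) * of_bool (j = k2)" for j k
    using brent_varietyD[OF q, of z2 k2 j k j2 z2] by (auto simp: mult_ac)
  have 3: "(\<Sum>i\<in>UNIV. q (Gamma i j k) * (q (Alpha i j3 z3) * q (Beta i z3 k3))) =
      of_bool (k = j3) * of_bool (j = k3)" for j k
    using brent_varietyD[OF q, of j3 z3 z3 k3 j k] by (auto simp: mult_ac)
  show "(\<Sum>i\<in>UNIV. P (Alpha i x1 y1) * (q (Beta i j1 z1) * q (Gamma i z1 k1))) = a $ x1 $ k1 * b' $ j1 $ y1"
    by (simp only: P_def brent_act.simps * 1 delta)
  show "(\<Sum>i\<in>UNIV. P (Beta i x2 y2) * (q (Gamma i j2 z2) * q (Alpha i z2 k2))) = b $ x2 $ k2 * c' $ j2 $ y2"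
    by (simp only: P_def brent_act.simps * 2 delta)
  show "(\<Sum>i\<in>UNIV. P (Gamma i x3 y3) * (q (Alpha i j3 z3) * q (Beta i z3 k3))) = c $ x3 $ k3 * a' $ j3 $ y3"
    by (simp only: P_def brent_act.simps * 3 delta)
qed

lemma brent_act_one: "brent_act (mat 1) (mat 1) (mat 1) (mat 1) (mat 1) (mat 1) q = q"
proof
  fix v
  have delta: "(\<Sum>(j, k)\<in>UNIV. mat 1 $ x $ j * mat 1 $ k $ y * f j k) = f x y"
    for f :: "'x::finite \<Rightarrow> 'y::finite \<Rightarrow> complex" and x y
  proof -
    have "(\<Sum>(j, k)\<in>UNIV. mat 1 $ x $ j * mat 1 $ k $ y * f j k) =
        (\<Sum>t\<in>UNIV. if t = (x, y) then f x y else 0)"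
      by (rule sum.cong) (auto simp: mat_def split: if_splits)
    then show ?thesis by simp
  qed
  show "brent_act (mat 1) (mat 1) (mat 1) (mat 1) (mat 1) (mat 1) q v = q v"
    by (cases v) (simp_all only: brent_act.simps delta)
qed

lemma poly_fn_brent_act:
  assumes "\<And>i j. poly_fn (\<lambda>s. a s $ i $ j)" "\<And>i j. poly_fn (\<lambda>s. a' s $ i $ j)"
    "\<And>i j. poly_fn (\<lambda>s. b s $ i $ j)" "\<And>i j. poly_fn (\<lambda>s. b' s $ i $ j)"
    "\<And>i j. poly_fn (\<lambda>s. c s $ i $ j)" "\<And>i j. poly_fn (\<lambda>s. c' s $ i $ j)"
  shows "poly_fn (\<lambda>s. brent_act (a s) (a' s) (b s) (b' s) (c s) (c' s) q v)"
  by (cases v) (auto simp: case_prod_unfold intro!: poly_fn_sum poly_fn.mult poly_fn.const assms)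

section \<open>The dimension bound at a solution\<close>

text \<open>The three parameter spaces are joined over a disjoint sum of index sets, so their
  dimensions add. The parametrized piece of the orbit passes through \<open>q\<close> at parameter
  0, where all matrices are the identity.\<close>

lemma local_dim_brent_variety_ge:
  fixes q :: "('m::finite, 'n::finite, 'p::finite, 'r::finite) brent_unknown point"
  assumes q: "q \<in> brent_variety"
  shows "enat (card (off_diagonal :: ('m \<times> 'm) set) + (card (off_diagonal :: ('n \<times> 'n) set)
    + card (off_diagonal :: ('p \<times> 'p) set))) \<le> local_dim brent_variety q"
proof -
  obtain a a' :: "('m \<times> 'm) point \<Rightarrow> complex^'m^'m" and l ga where
    a: "\<And>i j. poly_fn (\<lambda>s. a s $ i $ j)" "\<And>i j. poly_fn (\<lambda>s. a' s $ i $ j)"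
    "\<And>s. a s ** a' s = mat 1" "a (\<lambda>_. 0) = mat 1" "a' (\<lambda>_. 0) = mat 1"
    "\<And>s. a' s $ l $ l = 1" "\<And>t. poly_fn (\<lambda>x. ga x t)"
    "\<And>s. s \<in> coord_subspace off_diagonal \<Longrightarrow> ga (\<lambda>(i, j). a s $ i $ j) = s"
  proof (rule polynomial_matrix_family[where 'a = 'm], goal_cases)
    case prems: 1
    show ?case by (rule prems(1)[OF prems(2-)])
  qed
  obtain b b' :: "('n \<times> 'n) point \<Rightarrow> complex^'n^'n" and l' gb where
    b: "\<And>i j. poly_fn (\<lambda>s. b s $ i $ j)" "\<And>i j. poly_fn (\<lambda>s. b' s $ i $ j)"
    "\<And>s. b s ** b' s = mat 1" "b (\<lambda>_. 0) = mat 1" "b' (\<lambda>_. 0) = mat 1"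
    "\<And>s. b' s $ l' $ l' = 1" "\<And>t. poly_fn (\<lambda>x. gb x t)"
    "\<And>s. s \<in> coord_subspace off_diagonal \<Longrightarrow> gb (\<lambda>(i, j). b s $ i $ j) = s"
  proof (rule polynomial_matrix_family[where 'a = 'n], goal_cases)
    case prems: 1
    show ?case by (rule prems(1)[OF prems(2-)])
  qed
  obtain c c' :: "('p \<times> 'p) point \<Rightarrow> complex^'p^'p" and l'' gc where
    c: "\<And>i j. poly_fn (\<lambda>s. c s $ i $ j)" "\<And>i j. poly_fn (\<lambda>s. c' s $ i $ j)"
    "\<And>s. c s ** c' s = mat 1" "c (\<lambda>_. 0) = mat 1" "c' (\<lambda>_. 0) = mat 1"
    "\<And>s. c' s $ l'' $ l'' = 1" "\<And>t. poly_fn (\<lambda>x. gc x t)"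
    "\<And>s. s \<in> coord_subspace off_diagonal \<Longrightarrow> gc (\<lambda>(i, j). c s $ i $ j) = s"
  proof (rule polynomial_matrix_family[where 'a = 'p], goal_cases)
    case prems: 1
    show ?case by (rule prems(1)[OF prems(2-)])
  qed
  define \<phi> where "\<phi> = (\<lambda>s :: ('m \<times> 'm + 'n \<times> 'n + 'p \<times> 'p) point.
    brent_act (a (\<lambda>t. s (Inl t))) (a' (\<lambda>t. s (Inl t)))
      (b (\<lambda>t. s (Inr (Inl t)))) (b' (\<lambda>t. s (Inr (Inl t))))
      (c (\<lambda>t. s (Inr (Inr t)))) (c' (\<lambda>t. s (Inr (Inr t)))) q)"
  \<comment> \<open>By \<open>brent_act_entries\<close> the three sums at a point of the orbit are
    \<open>a $ i $ j\<close>, \<open>b $ i $ j\<close> and \<open>c $ i $ j\<close>, multiplied by a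
    last diagonal entry of \<open>b'\<close>, \<open>c'\<close> and \<open>a'\<close> respectively,
    which is 1. The sums are linear in \<open>x\<close>, since \<open>q\<close> is fixed.\<close>
  define \<psi> where "\<psi> = (\<lambda>x :: ('m, 'n, 'p, 'r) brent_unknown point. case_sum
    (ga (\<lambda>(i, j). \<Sum>r\<in>UNIV. x (Alpha r i l') * (q (Beta r l' l'') * q (Gamma r l'' j))))
    (case_sum
      (gb (\<lambda>(i, j). \<Sum>r\<in>UNIV. x (Beta r i l'') * (q (Gamma r l'' l) * q (Alpha r l j))))
      (gc (\<lambda>(i, j). \<Sum>r\<in>UNIV. x (Gamma r i l) * (q (Alpha r l l') * q (Beta r l' j))))))"
  let ?F = "off_diagonal <+> (off_diagonal <+> off_diagonal) :: ('m \<times> 'm + 'n \<times> 'n + 'p \<times> 'p) set"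
  have "enat (card ?F) \<le> local_dim brent_variety q"
  proof (rule local_dim_ge_embedded_subspace)
    have sub: "poly_fn (\<lambda>s. A (\<lambda>t. s (f t)) $ i $ j)" if "\<And>i j. poly_fn (\<lambda>s. A s $ i $ j)"
      for A :: "'x point \<Rightarrow> complex^'y^'y" and f :: "'x \<Rightarrow> 'm \<times> 'm + 'n \<times> 'n + 'p \<times> 'p" and i j
      by (rule poly_fn_compose[OF that]) (rule poly_fn.coord)
    show "poly_fn (\<lambda>s. \<phi> s v)" for v
      unfolding \<phi>_def
      by (rule poly_fn_brent_act; rule sub[OF a(1)] sub[OF a(2)] sub[OF b(1)] sub[OF b(2)]
          sub[OF c(1)] sub[OF c(2)])
    have lin: "poly_fn (\<lambda>x. case t of (i, j) \<Rightarrow> \<Sum>r\<in>UNIV. x (f r i j) * w r i j)"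
      for f :: "'r \<Rightarrow> 'x \<Rightarrow> 'y \<Rightarrow> ('m, 'n, 'p, 'r) brent_unknown" and w t
      by (cases t) (auto intro!: poly_fn_sum poly_fn.intros)
    show "poly_fn (\<lambda>x. \<psi> x t)" for t
    proof (cases t)
      case (Inl t1)
      then show ?thesis
        by (simp only: \<psi>_def sum.case) (intro poly_fn_compose[OF a(7)] lin)
    next
      case (Inr t')
      then show ?thesis
        by (cases t'; simp only: \<psi>_def sum.case)
          (intro poly_fn_compose[OF b(7)] lin, intro poly_fn_compose[OF c(7)] lin)
    qed
    show "\<psi> (\<phi> s) = s" if s: "s \<in> coord_subspace ?F" for s
    proof -
      have "(\<lambda>t. s (Inl t)) \<in> coord_subspace off_diagonal"
        "(\<lambda>t. s (Inr (Inl t))) \<in> coord_subspace off_diagonal"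
        "(\<lambda>t. s (Inr (Inr t))) \<in> coord_subspace off_diagonal"
        using s by (auto simp: coord_subspace_def)
      then show ?thesis
        unfolding \<psi>_def \<phi>_def brent_act_entries[OF q]
        by (simp only: a(6,8) b(6,8) c(6,8) mult_1_right) (auto split: sum.split)
    qed
    have "\<phi> (\<lambda>_. 0) = q"
      by (simp add: \<phi>_def a b c brent_act_one)
    moreover have "(\<lambda>_. 0) \<in> coord_subspace ?F" by (simp add: coord_subspace_def)
    ultimately show "q \<in> \<phi> ` coord_subspace ?F" by (metis image_eqI)
    show "\<phi> ` coord_subspace ?F \<subseteq> brent_variety"
      by (auto simp: \<phi>_def intro!: brent_act_in_variety q a b c)
  qed (auto simp: zariski_closed_brent_variety)
  then show ?thesis by (simp add: card_Plus)
qed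

theorem corollary3p19:
  fixes q :: "('m::finite, 'n::finite, 'p::finite, 'r::finite) brent_unknown \<Rightarrow> complex"
  assumes "q \<in> brent_variety"
    and "D_property (alg_u q) (alg_v q) (alg_w q)"
  shows "ereal_of_enat (local_dim brent_variety q) \<ge>
    ereal (real CARD('m) ^ 2 + real CARD('n) ^ 2 + real CARD('p) ^ 2
      - real CARD('m) - real CARD('n) - real CARD('p) - 3)"
proof -
  let ?N = "card (off_diagonal :: ('m \<times> 'm) set) + (card (off_diagonal :: ('n \<times> 'n) set)
    + card (off_diagonal :: ('p \<times> 'p) set))"
  \<comment> \<open>By \<open>card_off_diagonal\<close>, \<open>?N\<close> exceeds the left-hand
    side by exactly 3.\<close>
  have "ereal (real CARD('m) ^ 2 + real CARD('n) ^ 2 + real CARD('p) ^ 2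
      - real CARD('m) - real CARD('n) - real CARD('p) - 3) \<le> ereal (real ?N)"
    using card_off_diagonal[where 'a = 'm, THEN arg_cong[of _ _ real]]
      card_off_diagonal[where 'a = 'n, THEN arg_cong[of _ _ real]]
      card_off_diagonal[where 'a = 'p, THEN arg_cong[of _ _ real]] by simp
  also have "\<dots> = ereal_of_enat (enat ?N)" by simp
  also have "\<dots> \<le> ereal_of_enat (local_dim brent_variety q)"
    using local_dim_brent_variety_ge[OF assms(1)] by (simp only: ereal_of_enat_le_iff)
  finally show ?thesis .
qed

end
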